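(* Let $\gamma\subset\mathbb{R}^d$ be a self-similar Jordan arc. Suppose there is a hyperplane $\sigma$ in $\mathbb{R}^d$ such that for every $x\in\gamma$ the hyperplane parallel to $\sigma$ passing through $x$ intersects $\gamma$ only once (that is, only at the point $x$). Then $\gamma$ is a straight line segment.
   Context: A contraction similarity of $\mathbb{R}^d$ is a map of the form $S(x)=q\cdot O(x-x_0)+x_0$, where $x_0\in\mathbb{R}^d$ is its fixed point, $q\in(0,1)$ is its contraction ratio and $O$ is an orthogonal transformation. A Jordan arc in $\mathbb{R}^d$ is the image of an injective continuous map $[0,1]\to\mathbb{R}^d$. A Jordan arc $\gamma\subset\mathbb{R}^d$ is called self-similar if there is a finite system $\{S_1,\dots,S_m\}$ of contraction similarities of $\mathbb{R}^d$ such that $\gamma=\bigcup_{i=1}^m S_i(\gamma)$. *)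

theory Defs
  imports "HOL-Analysis.Analysis"
begin

definition contraction_similarity :: "('a::real_inner \<Rightarrow> 'a) \<Rightarrow> bool" where
  "contraction_similarity S \<longleftrightarrow>
     (\<exists>x0 q A. 0 < q \<and> q < 1 \<and> orthogonal_transformation A \<and>
        (\<forall>x. S x = q *\<^sub>R A (x - x0) + x0))"

definition jordan_arc :: "'a::topological_space set \<Rightarrow> bool" where
  "jordan_arc \<gamma> \<longleftrightarrow> (\<exists>g. arc g \<and> path_image g = \<gamma>)"

definition self_similar_jordan_arc :: "'a::real_inner set \<Rightarrow> bool" where
  "self_similar_jordan_arc \<gamma> \<longleftrightarrow>
     jordan_arc \<gamma> \<and>
     (\<exists>F. finite F \<and> (\<forall>S\<in>F. contraction_similarity S) \<and> \<gamma> = (\<Union>S\<in>F. S ` \<gamma>))"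

definition is_hyperplane :: "'a::real_inner set \<Rightarrow> bool" where
  "is_hyperplane \<sigma> \<longleftrightarrow> (\<exists>a b. a \<noteq> 0 \<and> \<sigma> = {x. a \<bullet> x = b})"

end

theory Submission
  imports Defs
begin

text \<open>
  The hypothesis on hyperplanes says that a linear functional $a$ is injective on the arc
  $\gamma$, so $\gamma$ is a graph over an interval in the direction $a$.  The similarities need
  not respect this direction.  The proof replaces $a$ by a functional $b$ that every similarity
  of the system merely rescales, and then shows that the graph over $b$ is straight by looking at
  its steepest chord.

  For the first step, orient the chords of $\gamma$ so that $a$ is positive on them.  Each $S$ of
  the system is injective and maps $\gamma$ into itself, hence it preserves or reverses the order
  of the arc, and its orthogonal part maps oriented chords to multiples of oriented chords up to
  one common sign.  These signed orthogonal maps preserve the cone of functionals that are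
  nonnegative on all oriented chords.  The point of least norm in the convex hull of unit vectors
  of that cone is fixed by all of them, because least-norm points are unique; this takes the place
  of averaging over a compact group of rotations (\<open>invariant_nonnegative_functional\<close>).  The
  resulting $b$ is a priori only weakly monotone along $\gamma$.  But if it were constant on a
  subarc, it would be constant on a small copy of $\gamma$ inside this subarc, and then, since the
  copy rescales $b$, on $\gamma$ itself (\<open>scaled_functional_strictly_monotone\<close>).

  For the second step, parametrise $\gamma$ by the value of $b$.  The slope
  $|x - y| / |b \cdot x - b \cdot y|$ of a chord does not change under the similarities of the
  system.  A short chord either lies in one piece and can be magnified, or is cut into two by a
  common end of two pieces.  This bounds all slopes by the slopes of long chords, so that
  the maximal slope is attained (\<open>self_affine_graph_attains_max_slope\<close>).  Between the ends of a
  steepest chord the triangle inequality leaves no slack, so the length of every chord there is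
  a fixed multiple of the increment of $b$.  A small copy of $\gamma$ lies there too; magnifying
  it back gives the same for all of $\gamma$, and equality in the triangle inequality makes
  $\gamma$ a segment.
\<close>

section \<open>A functional fixed by all maps that preserve a set of directions\<close>

lemma orthogonal_transformation_image_span:
  fixes T :: "'a::euclidean_space \<Rightarrow> 'a"
  assumes T: "orthogonal_transformation T" and TD: "T ` D \<subseteq> span D"
  shows "T ` span D = span D"
proof (rule subspace_dim_equal)
  have lin: "linear T" and inj: "inj T"
    using T orthogonal_transformation_linear orthogonal_transformation_inj by blast+
  show "subspace (T ` span D)"
    using linear_subspace_image lin subspace_span by blast
  show "subspace (span D)" by simp
  have "T ` span D = span (T ` D)" by (simp add: lin linear_span_image)
  also have "\<dots> \<subseteq> span D" using TD span_minimal by blast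
  finally show "T ` span D \<subseteq> span D" .
  have "inj_on T (span D)" using inj inj_on_subset by blast
  then show "dim (span D) \<le> dim (T ` span D)"
    using lin by (simp add: dim_image_eq span_span)
qed

text \<open>
  The nonnegative functionals on \<open>D\<close> form a cone that is preserved by the adjoint of every \<open>T\<close>,
  and a fixed point is found as the point of least norm in the convex hull \<open>C\<close> of unit vectors of
  this cone; \<open>a\<close> provides such a unit vector.  The danger is that the fixed point is zero.  It is
  avoided by restricting to functionals in the span of \<open>D\<close>: there a nonzero nonnegative
  functional cannot vanish on \<open>u0\<close>, since it would vanish on all of \<open>D\<close> and so be orthogonal to
  itself.  Thus \<open>C\<close> stays in the open half space of functionals positive on \<open>u0\<close>.
\<close>
lemma invariant_nonnegative_functional:
  fixes D :: "'a::euclidean_space set" and a u0 :: 'a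
  assumes orth: "\<And>T. T \<in> \<T> \<Longrightarrow> orthogonal_transformation T"
    and pres: "\<And>T u. T \<in> \<T> \<Longrightarrow> u \<in> D \<Longrightarrow> \<exists>r>0. r *\<^sub>R T u \<in> D"
    and pos: "\<And>u. u \<in> D \<Longrightarrow> 0 < a \<bullet> u"
    and u0: "u0 \<in> D"
    and order_unit: "\<And>c u. (\<And>v. v \<in> D \<Longrightarrow> 0 \<le> c \<bullet> v) \<Longrightarrow> c \<bullet> u0 = 0 \<Longrightarrow> u \<in> D \<Longrightarrow> c \<bullet> u = 0"
  obtains b where "\<And>T. T \<in> \<T> \<Longrightarrow> T b = b" "\<And>u. u \<in> D \<Longrightarrow> 0 \<le> b \<bullet> u" "0 < b \<bullet> u0"
proof -
  define Q where "Q = {c \<in> span D. norm c = 1 \<and> (\<forall>u\<in>D. 0 \<le> c \<bullet> u)}"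
  have "Q = sphere 0 1 \<inter> (span D \<inter> (\<Inter>u\<in>D. {c. 0 \<le> c \<bullet> u}))"
    by (auto simp: Q_def)
  moreover have "closed (\<Inter>u\<in>D. {c. 0 \<le> c \<bullet> u})"
    by (intro closed_INT ballI closed_Collect_le continuous_intros)
  ultimately have "compact Q"
    by (simp add: closed_Int compact_Int_closed)
  define C where "C = convex hull Q"
  have C: "compact C" "convex C" "closed C"
    using \<open>compact Q\<close> by (auto simp: C_def compact_convex_hull compact_imp_closed)
  \<comment> \<open>The projection of \<open>a\<close> to the span of \<open>D\<close> takes the same values on \<open>D\<close> as \<open>a\<close>.\<close>
  have "Q \<noteq> {}"
  proof -
    obtain y z where y: "y \<in> span D" and z: "\<And>w. w \<in> span D \<Longrightarrow> orthogonal z w" and "a = y + z"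
      using orthogonal_subspace_decomp_exists[of D a] by metis
    have ya: "y \<bullet> u = a \<bullet> u" if "u \<in> D" for u
      using z[of u] that \<open>a = y + z\<close> by (simp add: inner_add_left orthogonal_def span_base)
    have "y \<noteq> 0" using ya[OF u0] pos[OF u0] by auto
    have "0 \<le> (y /\<^sub>R norm y) \<bullet> u" if "u \<in> D" for u
      using ya[OF that] pos[OF that] by (simp add: less_imp_le)
    moreover have "y /\<^sub>R norm y \<in> span D" using y span_mul by blast
    ultimately have "y /\<^sub>R norm y \<in> Q"
      using \<open>y \<noteq> 0\<close> unfolding Q_def by simp
    then show ?thesis by blast
  qed
  have Qu0: "Q \<subseteq> {c. 0 < c \<bullet> u0}"
  proof
    fix c assume c: "c \<in> Q"
    have "c \<bullet> u0 \<noteq> 0"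
    proof
      assume "c \<bullet> u0 = 0"
      then have "\<And>u. u \<in> D \<Longrightarrow> orthogonal c u"
        using order_unit[of c] c unfolding Q_def orthogonal_def by blast
      then have "orthogonal c c"
        using c orthogonal_to_span unfolding Q_def by blast
      then show False using c by (auto simp: Q_def orthogonal_def)
    qed
    then show "c \<in> {c. 0 < c \<bullet> u0}"
      using c u0 by (auto simp: Q_def less_le)
  qed
  have Cu0: "C \<subseteq> {c. 0 < c \<bullet> u0}"
    unfolding C_def
    using Qu0 convex_halfspace_gt[of 0 u0] by (simp add: hull_minimal inner_commute)
  have Cpos: "0 \<le> c \<bullet> u" if "c \<in> C" "u \<in> D" for c u
  proof -
    have "C \<subseteq> {c. 0 \<le> c \<bullet> u}"
      unfolding C_def using convex_halfspace_ge[of 0 u] that(2)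
      by (intro hull_minimal) (auto simp: Q_def inner_commute)
    then show ?thesis using that(1) by blast
  qed
  \<comment> \<open>It is the adjoint of \<open>T\<close>, its inverse, that maps \<open>C\<close> into itself.  Stated with the image
    under \<open>T\<close>, this needs no name for the adjoint.\<close>
  have CT: "C \<subseteq> T ` C" if "T \<in> \<T>" for T
  proof -
    have T: "orthogonal_transformation T" using orth that by blast
    have "T ` D \<subseteq> span D"
    proof
      fix w assume "w \<in> T ` D"
      then obtain r where "0 < r" "r *\<^sub>R w \<in> D" using pres[OF \<open>T \<in> \<T>\<close>] by blast
      then have "inverse r *\<^sub>R r *\<^sub>R w \<in> span D" using span_base span_mul by blast
      then show "w \<in> span D" using \<open>0 < r\<close> by simp
    qed
    then have TV: "T ` span D = span D"
      using T orthogonal_transformation_image_span by blast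
    have "Q \<subseteq> T ` Q"
    proof
      fix c assume c: "c \<in> Q"
      then obtain c' where c': "c' \<in> span D" "c = T c'" using TV by (auto simp: Q_def)
      have "0 \<le> c' \<bullet> u" if u: "u \<in> D" for u
      proof -
        obtain r where r: "0 < r" "r *\<^sub>R T u \<in> D" using pres[OF \<open>T \<in> \<T>\<close> u] by blast
        have "0 \<le> c \<bullet> (r *\<^sub>R T u)" using c r by (auto simp: Q_def)
        moreover have "c \<bullet> T u = c' \<bullet> u" using T c' by (simp add: orthogonal_transformation_def)
        ultimately show ?thesis using r by (simp add: zero_le_mult_iff)
      qed
      moreover have "norm c' = 1"
        using c c' T by (auto simp: Q_def orthogonal_transformation)
      ultimately show "c \<in> T ` Q" using c' by (auto simp: Q_def)
    qed
    then have "C \<subseteq> convex hull (T ` Q)" by (simp add: C_def hull_mono)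
    also have "\<dots> = T ` C"
      using T orthogonal_transformation_linear by (metis C_def convex_hull_linear_image)
    finally show ?thesis .
  qed
  have "C \<noteq> {}" using \<open>Q \<noteq> {}\<close> by (simp add: C_def)
  define b where "b = closest_point C 0"
  have b: "b \<in> C" and bmin: "\<And>c. c \<in> C \<Longrightarrow> norm b \<le> norm c"
    using closest_point_in_set[of C 0] closest_point_le[of C _ 0] C \<open>C \<noteq> {}\<close>
    by (auto simp: b_def)
  have "T b = b" if T: "T \<in> \<T>" for T
  proof -
    obtain b' where b': "b' \<in> C" "b = T b'" using CT[OF T] b by blast
    have "norm b' = norm b"
      using b' orth[OF T] by (simp add: orthogonal_transformation)
    have "b' = b"
    proof (rule any_closest_point_unique[OF C(2,3) b'(1) b])
      show "\<forall>c\<in>C. dist 0 b' \<le> dist 0 c" using bmin \<open>norm b' = norm b\<close> by simp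
      show "\<forall>c\<in>C. dist 0 b \<le> dist 0 c" using bmin by simp
    qed
    then show ?thesis using b'(2) by simp
  qed
  moreover have "0 < b \<bullet> u0" using b Cu0 by blast
  ultimately show ?thesis using that[of b] Cpos[OF b] by blast
qed

section \<open>A functional scaled by all similarities of the system\<close>

text \<open>
  The sign of the factor \<open>m\<close> records whether \<open>S\<close> keeps or reverses the direction in which \<open>b\<close>
  grows; its absolute value has to be the similarity ratio itself, so that slopes of chords
  relative to \<open>b\<close> are preserved.
\<close>
definition scales_by :: "'a::real_inner \<Rightarrow> real \<Rightarrow> ('a \<Rightarrow> 'a) \<Rightarrow> bool" where
  "scales_by b m S \<longleftrightarrow>
     (\<forall>x y. dist (S x) (S y) = \<bar>m\<bar> * dist x y) \<and> (\<forall>x y. b \<bullet> S x - b \<bullet> S y = m * (b \<bullet> x - b \<bullet> y))"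

lemma scales_by_comp:
  "scales_by b m S \<Longrightarrow> scales_by b n W \<Longrightarrow> scales_by b (m * n) (S \<circ> W)"
  by (simp add: scales_by_def abs_mult)

lemma strictly_monotone_along_arc:
  fixes g :: "real \<Rightarrow> 'a::real_inner"
  assumes "arc g" and inj: "inj_on ((\<bullet>) a) (path_image g)"
  obtains a' where "strict_mono_on {0..1} (\<lambda>t. a' \<bullet> g t)"
proof -
  have cont: "continuous_on {0..1} (\<lambda>t. a \<bullet> g t)"
    using \<open>arc g\<close> by (auto intro!: continuous_intros simp: arc_def path_def)
  have "inj_on (\<lambda>t. a \<bullet> g t) {0..1}"
    using inj \<open>arc g\<close> by (auto simp: inj_on_def arc_def path_image_def)
  then consider "strict_mono_on {0..1} (\<lambda>t. a \<bullet> g t)" | "strict_antimono_on {0..1} (\<lambda>t. a \<bullet> g t)"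
    using injective_eq_monotone_map[OF _ cont] by (auto simp: is_interval_cc)
  then show ?thesis
  proof cases
    case 1
    then show ?thesis using that by blast
  next
    case 2
    then have "strict_mono_on {0..1} (\<lambda>t. (- a) \<bullet> g t)"
      by (auto simp: monotone_on_def)
    then show ?thesis using that by blast
  qed
qed

text \<open>
  The set \<open>D\<close> of chords oriented along the arc takes the role of the directions in the previous
  section.  The total chord \<open>g 1 - g 0\<close> is the sum of the three consecutive chords cut out by any
  two points, so a functional that is nonnegative on \<open>D\<close> and zero on the total chord is zero on \<open>D\<close>.
\<close>
lemma common_scaled_functional:
  fixes g :: "real \<Rightarrow> 'a::euclidean_space"
  assumes g: "arc g" and mono: "strict_mono_on {0..1} (\<lambda>t. a \<bullet> g t)"
    and F: "\<And>S. S \<in> F \<Longrightarrow> contraction_similarity S"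
    and Fg: "\<And>S. S \<in> F \<Longrightarrow> S ` path_image g \<subseteq> path_image g"
  obtains b where "mono_on {0..1} (\<lambda>t. b \<bullet> g t)" "b \<bullet> g 0 < b \<bullet> g 1"
    "\<And>S. S \<in> F \<Longrightarrow> \<exists>m. 0 < \<bar>m\<bar> \<and> \<bar>m\<bar> < 1 \<and> scales_by b m S"
proof -
  define D where "D = {g t - g s |s t. 0 \<le> s \<and> s < t \<and> t \<le> 1}"
  define \<T> where "\<T> = {T. orthogonal_transformation T \<and> (\<forall>u\<in>D. \<exists>r>0. r *\<^sub>R T u \<in> D)}"
  have u0: "g 1 - g 0 \<in> D" unfolding D_def by force
  have less: "a \<bullet> g s < a \<bullet> g t" if "0 \<le> s" "s < t" "t \<le> 1" for s t
    using mono that by (auto simp: monotone_on_def)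
  have less_iff: "s < t" if "a \<bullet> g s < a \<bullet> g t" "s \<in> {0..1}" "t \<in> {0..1}" for s t
    using less[of t s] that by (cases s t rule: linorder_cases) auto
  obtain b where Tb: "\<And>T. T \<in> \<T> \<Longrightarrow> T b = b"
    and bpos: "\<And>u. u \<in> D \<Longrightarrow> 0 \<le> b \<bullet> u" and bu0: "0 < b \<bullet> (g 1 - g 0)"
  proof (rule invariant_nonnegative_functional[of \<T> D a "g 1 - g 0"])
    fix c u assume c: "\<And>v. v \<in> D \<Longrightarrow> 0 \<le> c \<bullet> v" and c0: "c \<bullet> (g 1 - g 0) = 0" and "u \<in> D"
    then obtain s t where st: "0 \<le> s" "s < t" "t \<le> 1" "u = g t - g s" by (auto simp: D_def)
    have "c \<bullet> g x \<le> c \<bullet> g y" if "0 \<le> x" "x \<le> y" "y \<le> 1" for x y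
      using c[of "g y - g x"] that by (cases "x = y") (force simp: D_def inner_diff_right)+
    from this[of 0 s] this[of s t] this[of t 1] show "c \<bullet> u = 0"
      using st c0 by (simp add: inner_diff_right)
  qed (use u0 less in \<open>auto simp: \<T>_def D_def inner_diff_right\<close>)
  show ?thesis
  proof (rule that)
    show "mono_on {0..1} (\<lambda>t. b \<bullet> g t)"
    proof (rule mono_onI)
      fix s t :: real assume "s \<in> {0..1}" "t \<in> {0..1}" "s \<le> t"
      then show "b \<bullet> g s \<le> b \<bullet> g t"
        using bpos[of "g t - g s"] by (cases "s = t") (force simp: D_def inner_diff_right)+
    qed
    show "b \<bullet> g 0 < b \<bullet> g 1" using bu0 by (simp add: inner_diff_right)
    fix S assume S: "S \<in> F"
    then obtain x0 q A where q: "0 < q" "q < 1" and A: "orthogonal_transformation A"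
      and SA: "\<And>x. S x = q *\<^sub>R A (x - x0) + x0"
      using F unfolding contraction_similarity_def by metis
    have lin: "linear A" using A orthogonal_transformation_linear by blast
    have diff: "S x - S y = q *\<^sub>R A (x - y)" for x y
      using linear_diff[OF lin, of "x - x0" "y - x0"] by (simp add: SA flip: scaleR_right_diff_distrib)
    have "continuous_on UNIV A" using lin linear_continuous_on linear_linear by blast
    then have Acont: "continuous_on X (\<lambda>t. A (h t))" if "continuous_on X h" for h and X :: "real set"
      using continuous_on_compose2[OF _ that, of UNIV A] by auto
    have cont: "continuous_on {0..1} (\<lambda>t. a \<bullet> S (g t))"
      using g unfolding SA by (auto intro!: continuous_intros Acont simp: arc_def path_def)
    have Sg: "\<exists>s\<in>{0..1}. S (g t) = g s" if "t \<in> {0..1}" for t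
      using Fg[OF S] that unfolding path_image_def by blast
    \<comment> \<open>An injective continuous function on an interval is monotone; this gives the sign \<open>e\<close>
      with which \<open>S\<close> acts on the order of the arc.\<close>
    have "inj_on (\<lambda>t. a \<bullet> S (g t)) {0..1}"
    proof (rule inj_onI)
      fix s t assume st: "s \<in> {0..1}" "t \<in> {0..1}" and eq: "a \<bullet> S (g s) = a \<bullet> S (g t)"
      obtain s' t' where s't': "s' \<in> {0..1}" "t' \<in> {0..1}" "S (g s) = g s'" "S (g t) = g t'"
        using Sg st by metis
      then have "s' = t'"
        using eq less[of s' t'] less[of t' s'] by (cases s' t' rule: linorder_cases) auto
      then have "q *\<^sub>R A (g s - g t) = 0" using diff[of "g s" "g t"] s't' by simp
      then have "norm (A (g s - g t)) = 0" using q by simp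
      then have "norm (g s - g t) = 0" using A by (metis orthogonal_transformation)
      then have "g s = g t" by simp
      then show "s = t" using g st by (auto simp: arc_def inj_on_def)
    qed
    then consider "strict_mono_on {0..1} (\<lambda>t. a \<bullet> S (g t))" | "strict_antimono_on {0..1} (\<lambda>t. a \<bullet> S (g t))"
      using injective_eq_monotone_map[OF _ cont] by (auto simp: is_interval_cc)
    then obtain e :: real where e: "\<bar>e\<bar> = 1"
      and emono: "\<And>s t. 0 \<le> s \<Longrightarrow> s < t \<Longrightarrow> t \<le> 1 \<Longrightarrow> 0 < e * (a \<bullet> S (g t) - a \<bullet> S (g s))"
    proof cases
      case 1
      then show ?thesis by (intro that[of 1]) (auto simp: monotone_on_def)
    next
      case 2
      then show ?thesis by (intro that[of "-1"]) (auto simp: monotone_on_def)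
    qed
    then have e_cases: "e = 1 \<or> e = -1" by (simp add: abs_if split: if_splits)
    have "(\<lambda>x. e *\<^sub>R A x) \<in> \<T>"
      unfolding \<T>_def
    proof (intro CollectI conjI ballI)
      show "orthogonal_transformation (\<lambda>x. e *\<^sub>R A x)"
        using A e lin by (simp add: orthogonal_transformation linear_compose_scale_right)
      fix u assume "u \<in> D"
      then obtain s t where st: "0 \<le> s" "s < t" "t \<le> 1" "u = g t - g s" by (auto simp: D_def)
      then obtain s' t' where s't': "s' \<in> {0..1}" "t' \<in> {0..1}" "S (g s) = g s'" "S (g t) = g t'"
        using Sg[of s] Sg[of t] by auto
      have qu: "q *\<^sub>R e *\<^sub>R A u = e *\<^sub>R (g t' - g s')"
        using diff[of "g t" "g s"] s't' st by (simp add: scaleR_left_commute)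
      have "0 < e * (a \<bullet> g t' - a \<bullet> g s')" using emono[of s t] st s't' by simp
      then have "e *\<^sub>R (g t' - g s') \<in> D"
        using e_cases less_iff[of s' t'] less_iff[of t' s'] s't' unfolding D_def by force
      then show "\<exists>r>0. r *\<^sub>R (e *\<^sub>R A u) \<in> D" using qu q by metis
    qed
    then have "e *\<^sub>R A b = b" using Tb by blast
    moreover have "e * e = 1" using e_cases by auto
    ultimately have "A b = e *\<^sub>R b" by (metis scaleR_one scaleR_scaleR)
    then have Ab: "b \<bullet> A x = e * (b \<bullet> x)" for x
      using A e_cases unfolding orthogonal_transformation_def
      by (metis \<open>e * e = 1\<close> inner_scaleR_left mult.assoc mult.left_commute mult_1)
    have "scales_by b (e * q) S"
      unfolding scales_by_def
    proof (intro conjI allI)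
      fix x y
      have "norm (A (x - y)) = norm (x - y)" using A by (simp add: orthogonal_transformation)
      then show "dist (S x) (S y) = \<bar>e * q\<bar> * dist x y"
        using q e by (simp add: dist_norm diff abs_mult)
      have "b \<bullet> S x - b \<bullet> S y = b \<bullet> (S x - S y)" by (simp add: inner_diff_right)
      then show "b \<bullet> S x - b \<bullet> S y = e * q * (b \<bullet> x - b \<bullet> y)"
        by (simp add: diff Ab inner_diff_right)
    qed
    then show "\<exists>m. 0 < \<bar>m\<bar> \<and> \<bar>m\<bar> < 1 \<and> scales_by b m S"
      using q e by (intro exI[of _ "e * q"]) (auto simp: abs_mult)
  qed
qed

section \<open>Small copies of a self-similar set\<close>

text \<open>
  Statements about a small part of \<open>\<gamma>\<close> are transferred to all of \<open>\<gamma>\<close> by magnifying a copy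
  \<open>W ` \<gamma>\<close> contained in that part.  The map \<open>W\<close> is a composition of \<open>n\<close> maps of the system such
  that the copy contains \<open>z\<close>, and its ratio is at most the \<open>n\<close>-th power of the largest ratio in
  the system.
\<close>
lemma arbitrarily_small_copy:
  assumes "finite F" and \<gamma>: "\<gamma> = (\<Union>S\<in>F. S ` \<gamma>)" and "bounded \<gamma>" and "z \<in> \<gamma>"
    and scale: "\<And>S. S \<in> F \<Longrightarrow> \<exists>m. 0 < \<bar>m\<bar> \<and> \<bar>m\<bar> < 1 \<and> scales_by b m S"
    and "0 < \<delta>"
  obtains W m where "m \<noteq> 0" "scales_by b m W" "W ` \<gamma> \<subseteq> \<gamma>" "W ` \<gamma> \<subseteq> ball z \<delta>"
proof -
  obtain m where m: "\<And>S. S \<in> F \<Longrightarrow> 0 < \<bar>m S\<bar> \<and> \<bar>m S\<bar> < 1 \<and> scales_by b (m S) S"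
    using scale by metis
  have "F \<noteq> {}" using \<gamma> \<open>z \<in> \<gamma>\<close> by auto
  define \<rho> where "\<rho> = Max ((\<lambda>S. \<bar>m S\<bar>) ` F)"
  have \<rho>: "\<bar>m S\<bar> \<le> \<rho>" if "S \<in> F" for S
    unfolding \<rho>_def using that \<open>finite F\<close> by simp
  have "\<rho> < 1" unfolding \<rho>_def using \<open>finite F\<close> \<open>F \<noteq> {}\<close> m by (subst Max_less_iff) auto
  have "0 \<le> \<rho>" using \<rho> \<open>F \<noteq> {}\<close> abs_ge_zero order_trans by (metis ex_in_conv)
  have step: "\<exists>W k. k \<noteq> 0 \<and> \<bar>k\<bar> \<le> \<rho> ^ n \<and> scales_by b k W \<and> W ` \<gamma> \<subseteq> \<gamma> \<and> z \<in> W ` \<gamma>"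
    if "z \<in> \<gamma>" for n z
    using that
  proof (induction n arbitrary: z)
    case 0
    then show ?case by (intro exI[of _ id] exI[of _ 1]) (auto simp: scales_by_def)
  next
    case (Suc n)
    then obtain S y where S: "S \<in> F" "y \<in> \<gamma>" "z = S y" using \<gamma> by blast
    obtain W k where W: "k \<noteq> 0" "\<bar>k\<bar> \<le> \<rho> ^ n" "scales_by b k W" "W ` \<gamma> \<subseteq> \<gamma>" "y \<in> W ` \<gamma>"
      using Suc.IH[OF \<open>y \<in> \<gamma>\<close>] by blast
    have "S ` \<gamma> \<subseteq> \<gamma>" using S(1) \<gamma> by blast
    show ?case
    proof (intro exI conjI)
      show "m S * k \<noteq> 0" using m[OF S(1)] W(1) by auto
      show "\<bar>m S * k\<bar> \<le> \<rho> ^ Suc n"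
        using W(2) \<rho>[OF S(1)] \<open>0 \<le> \<rho>\<close> by (simp add: abs_mult mult_mono)
      show "scales_by b (m S * k) (S \<circ> W)" using m[OF S(1)] W(3) scales_by_comp by blast
      show "(S \<circ> W) ` \<gamma> \<subseteq> \<gamma>" using W(4) \<open>S ` \<gamma> \<subseteq> \<gamma>\<close> by (auto simp: image_subset_iff)
      show "z \<in> (S \<circ> W) ` \<gamma>" using W(5) S(3) by auto
    qed
  qed
  obtain M where "0 < M" and M: "\<And>x y. x \<in> \<gamma> \<Longrightarrow> y \<in> \<gamma> \<Longrightarrow> dist x y \<le> M"
    using \<open>bounded \<gamma>\<close> unfolding bounded_two_points
    by (metis less_le_trans linorder_le_less_linear order_less_imp_le zero_less_one order_trans)
  obtain n where n: "\<rho> ^ n < \<delta> / M"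
    using real_arch_pow_inv[of "\<delta> / M" \<rho>] \<open>\<rho> < 1\<close> \<open>0 < \<delta>\<close> \<open>0 < M\<close> by auto
  obtain W k where W: "k \<noteq> 0" "\<bar>k\<bar> \<le> \<rho> ^ n" "scales_by b k W" "W ` \<gamma> \<subseteq> \<gamma>" "z \<in> W ` \<gamma>"
    using step[OF \<open>z \<in> \<gamma>\<close>] by blast
  obtain y where y: "y \<in> \<gamma>" "z = W y" using W(5) by blast
  have "W ` \<gamma> \<subseteq> ball z \<delta>"
  proof
    fix w assume "w \<in> W ` \<gamma>"
    then obtain x where x: "x \<in> \<gamma>" "w = W x" by blast
    have "dist z w = \<bar>k\<bar> * dist y x" using W(3) x y by (simp add: scales_by_def)
    also have "\<dots> \<le> \<rho> ^ n * M"
      using W(2) M[OF y(1) x(1)] \<open>0 \<le> \<rho>\<close> by (intro mult_mono) auto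
    also have "\<dots> < \<delta>" using n \<open>0 < M\<close> by (simp add: pos_less_divide_eq)
    finally show "w \<in> ball z \<delta>" by simp
  qed
  then show ?thesis using that W by blast
qed

text \<open>
  The functional \<open>a\<close> is used to recognise subarcs: the points of the arc strictly between
  \<open>g s\<close> and \<open>g t\<close> are cut out by open half spaces, so a small enough copy around one of them
  stays between them.  If \<open>b\<close> were constant there, it would take equal values at the two ends of
  the copy, and hence at the two ends of the arc.
\<close>
lemma scaled_functional_strictly_monotone:
  fixes g :: "real \<Rightarrow> 'a::real_inner"
  assumes "arc g" and a: "strict_mono_on {0..1} (\<lambda>t. a \<bullet> g t)"
    and "finite F" and \<gamma>: "path_image g = (\<Union>S\<in>F. S ` path_image g)"
    and b: "mono_on {0..1} (\<lambda>t. b \<bullet> g t)" "b \<bullet> g 0 < b \<bullet> g 1"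
    and scale: "\<And>S. S \<in> F \<Longrightarrow> \<exists>m. 0 < \<bar>m\<bar> \<and> \<bar>m\<bar> < 1 \<and> scales_by b m S"
  shows "strict_mono_on {0..1} (\<lambda>t. b \<bullet> g t)"
proof (rule strict_mono_onI)
  fix s t :: real assume st: "s \<in> {0..1}" "t \<in> {0..1}" "s < t"
  have less: "x < y" if "a \<bullet> g x < a \<bullet> g y" "x \<in> {0..1}" "y \<in> {0..1}" for x y
    using strict_mono_on_leD[OF a, of y x] that by force
  show "b \<bullet> g s < b \<bullet> g t"
  proof (rule ccontr)
    assume "\<not> b \<bullet> g s < b \<bullet> g t"
    define z where "z = g ((s + t) / 2)"
    define N where "N = {w. a \<bullet> g s < a \<bullet> w} \<inter> {w. a \<bullet> w < a \<bullet> g t}"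
    have "open N" unfolding N_def by (intro open_Int open_Collect_less continuous_intros)
    moreover have "z \<in> N"
      using st strict_mono_onD[OF a, of s "(s + t) / 2"] strict_mono_onD[OF a, of "(s + t) / 2" t]
      by (auto simp: N_def z_def)
    ultimately obtain \<delta> where \<delta>: "0 < \<delta>" "ball z \<delta> \<subseteq> N" using open_contains_ball by blast
    have z: "z \<in> path_image g" using st by (auto simp: z_def path_image_def)
    have bounded: "bounded (path_image g)"
      using \<open>arc g\<close> by (simp add: arc_imp_path bounded_path_image)
    obtain W m where W: "m \<noteq> 0" "scales_by b m W" "W ` path_image g \<subseteq> path_image g"
        "W ` path_image g \<subseteq> ball z \<delta>"
      by (rule arbitrarily_small_copy[OF \<open>finite F\<close> \<gamma> bounded z scale \<delta>(1)])
    have const: "b \<bullet> W (g x) = b \<bullet> g s" if x: "x \<in> {0..1}" for x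
    proof -
      have Wx: "W (g x) \<in> path_image g" "W (g x) \<in> N"
        using W(3,4) \<delta>(2) x unfolding path_image_def by blast+
      then obtain r where r: "r \<in> {0..1}" "W (g x) = g r" by (auto simp: path_image_def)
      then have "s < r" "r < t" using Wx(2) less[of s r] less[of r t] st by (auto simp: N_def)
      then have "b \<bullet> g s \<le> b \<bullet> g r" "b \<bullet> g r \<le> b \<bullet> g t"
        using mono_onD[OF b(1)] st r by auto
      then show ?thesis using \<open>\<not> b \<bullet> g s < b \<bullet> g t\<close> r(2) by simp
    qed
    have "b \<bullet> W (g 1) - b \<bullet> W (g 0) = m * (b \<bullet> g 1 - b \<bullet> g 0)"
      using W(2) unfolding scales_by_def by blast
    then show False using const[of 0] const[of 1] W(1) b(2) by simp
  qed
qed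

section \<open>The steepest chord of a self-affine graph\<close>

text \<open>
  The piece \<open>i\<close> of the graph lies over the interval from \<open>lo i\<close> to \<open>hi i\<close>, and slopes in it are
  slopes of the whole graph at larger scale.  On pairs at distance at least \<open>\<kappa>\<close> the slope has a
  maximum \<open>L\<close> by compactness, and it remains to bound the slope of close pairs by \<open>L\<close>.

  A close pair that lies over one piece can be magnified until it is no longer close.  The pairs
  not over one piece are the difficulty, because cutting a pair in two makes it smaller, and
  repeated cutting and magnifying need not end.  The choice of \<open>\<kappa>\<close> as the smallest gap between
  ends of pieces solves this: a close pair that is not over one piece can be cut at a point that is
  an end of a piece over either half.  Each half then magnifies to a pair containing an end \<open>\<alpha>\<close>
  or \<open>\<beta>\<close> of the whole interval, and a close pair of this kind always lies over a piece with that
  same end, so it can be magnified without any further cut.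
\<close>
lemma self_affine_graph_attains_max_slope:
  fixes G :: "real \<Rightarrow> 'a::metric_space" and m c :: "'i \<Rightarrow> real"
  assumes "\<alpha> < \<beta>" and "finite I" and G: "continuous_on {\<alpha>..\<beta>} G"
    and m: "\<And>i. i \<in> I \<Longrightarrow> 0 < \<bar>m i\<bar> \<and> \<bar>m i\<bar> < 1"
    and cover: "{\<alpha>..\<beta>} = (\<Union>i\<in>I. (\<lambda>t. m i * t + c i) ` {\<alpha>..\<beta>})"
    and similar: "\<And>i s t. i \<in> I \<Longrightarrow> s \<in> {\<alpha>..\<beta>} \<Longrightarrow> t \<in> {\<alpha>..\<beta>} \<Longrightarrow>
        dist (G (m i * s + c i)) (G (m i * t + c i)) = \<bar>m i\<bar> * dist (G s) (G t)"
  obtains L s t where "\<alpha> \<le> s" "s < t" "t \<le> \<beta>" "dist (G s) (G t) = L * (t - s)"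
    "\<And>u v. u \<in> {\<alpha>..\<beta>} \<Longrightarrow> v \<in> {\<alpha>..\<beta>} \<Longrightarrow> dist (G u) (G v) \<le> L * \<bar>u - v\<bar>"
proof -
  define lo where "lo i = min (m i * \<alpha> + c i) (m i * \<beta> + c i)" for i
  define hi where "hi i = max (m i * \<alpha> + c i) (m i * \<beta> + c i)" for i
  have J: "(\<lambda>t. m i * t + c i) ` {\<alpha>..\<beta>} = {lo i..hi i}" if "i \<in> I" for i
  proof (cases "0 \<le> m i")
    case True
    then have "m i * \<alpha> \<le> m i * \<beta>" using \<open>\<alpha> < \<beta>\<close> by (simp add: mult_left_mono)
    then show ?thesis
      using True \<open>\<alpha> < \<beta>\<close> by (simp add: image_affinity_atLeastAtMost lo_def hi_def)
  next
    case False
    then have "m i * \<beta> \<le> m i * \<alpha>" using \<open>\<alpha> < \<beta>\<close> by (simp add: mult_left_mono_neg)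
    then show ?thesis
      using False \<open>\<alpha> < \<beta>\<close> by (simp add: image_affinity_atLeastAtMost lo_def hi_def)
  qed
  have piece: "\<exists>i\<in>I. lo i \<le> x \<and> x \<le> hi i" if "x \<in> {\<alpha>..\<beta>}" for x
  proof -
    have "x \<in> (\<Union>i\<in>I. (\<lambda>t. m i * t + c i) ` {\<alpha>..\<beta>})" using that by (subst cover[symmetric])
    then show ?thesis using J by auto
  qed
  have range: "\<alpha> \<le> lo i" "hi i \<le> \<beta>" "lo i < hi i" if "i \<in> I" for i
  proof -
    have "m i * \<alpha> \<noteq> m i * \<beta>" using m[OF that] \<open>\<alpha> < \<beta>\<close> by auto
    then show "lo i < hi i" unfolding lo_def hi_def by linarith
    moreover have "{lo i..hi i} \<subseteq> {\<alpha>..\<beta>}" using J[OF that] cover that by blast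
    ultimately show "\<alpha> \<le> lo i" "hi i \<le> \<beta>" by auto
  qed
  have "I \<noteq> {}" using piece[of \<alpha>] \<open>\<alpha> < \<beta>\<close> by auto
  define E where "E = {\<alpha>, \<beta>} \<union> lo ` I \<union> hi ` I"
  have E: "\<alpha> \<in> E" "\<beta> \<in> E" "\<And>i. i \<in> I \<Longrightarrow> lo i \<in> E" "\<And>i. i \<in> I \<Longrightarrow> hi i \<in> E"
    by (auto simp: E_def)
  define K where "K = (\<lambda>(x, y). \<bar>x - y\<bar>) ` {(x, y) \<in> E \<times> E. x \<noteq> y}"
  have "finite E" using \<open>finite I\<close> by (simp add: E_def)
  then have "finite {(x, y) \<in> E \<times> E. x \<noteq> y}"
    by (rule_tac finite_subset[of _ "E \<times> E"]) auto
  then have "finite K" by (simp add: K_def)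
  have KI: "\<bar>x - y\<bar> \<in> K" if "x \<in> E" "y \<in> E" "x \<noteq> y" for x y
    using that unfolding K_def by force
  have "K \<noteq> {}" using KI[OF E(1,2)] \<open>\<alpha> < \<beta>\<close> by auto
  define \<kappa> where "\<kappa> = Min K"
  have "0 < \<kappa>"
    unfolding \<kappa>_def using \<open>finite K\<close> \<open>K \<noteq> {}\<close> by (subst Min_gr_iff) (auto simp: K_def)
  have gap: "\<kappa> \<le> \<bar>x - y\<bar>" if "x \<in> E" "y \<in> E" "x \<noteq> y" for x y
    unfolding \<kappa>_def using KI[OF that] \<open>finite K\<close> by simp
  define \<rho> where "\<rho> = Max ((\<lambda>i. \<bar>m i\<bar>) ` I)"
  have \<rho>: "\<bar>m i\<bar> \<le> \<rho>" if "i \<in> I" for i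
    unfolding \<rho>_def using that \<open>finite I\<close> by simp
  have "\<rho> < 1" unfolding \<rho>_def using \<open>finite I\<close> \<open>I \<noteq> {}\<close> m by (subst Max_less_iff) auto
  have "0 < \<rho>" using \<rho> m \<open>I \<noteq> {}\<close> by (metis ex_in_conv less_le_trans)

  define R where "R = ({\<alpha>..\<beta>} \<times> {\<alpha>..\<beta>}) \<inter> {p. fst p + \<kappa> \<le> snd p}"
  have "compact R"
    unfolding R_def
    by (intro compact_Int_closed compact_Times compact_Icc closed_Collect_le continuous_intros)
  moreover have "(\<alpha>, \<beta>) \<in> R"
    using gap[OF E(1,2)] \<open>\<alpha> < \<beta>\<close> by (auto simp: R_def)
  moreover have "continuous_on R (\<lambda>p. dist (G (fst p)) (G (snd p)) / (snd p - fst p))"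
    using \<open>0 < \<kappa>\<close> by (intro continuous_intros continuous_on_compose2[OF G]) (auto simp: R_def)
  ultimately obtain p where p: "p \<in> R" and pmax: "\<And>q. q \<in> R \<Longrightarrow>
      dist (G (fst q)) (G (snd q)) / (snd q - fst q) \<le> dist (G (fst p)) (G (snd p)) / (snd p - fst p)"
    using continuous_attains_sup[of R] by blast
  define L where "L = dist (G (fst p)) (G (snd p)) / (snd p - fst p)"
  define good where "good u v \<longleftrightarrow> dist (G u) (G v) \<le> L * \<bar>u - v\<bar>" for u v
  have good_sym: "good v u" if "good u v" for u v
    using that by (simp add: good_def dist_commute abs_minus_commute)
  have good_trans: "good u w" if "good u v" "good v w" "u \<le> v" "v \<le> w" for u v w
    using that dist_triangle[of "G u" "G w" "G v"] by (simp add: good_def algebra_simps)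
  have far: "good u v" if uv: "u \<in> {\<alpha>..\<beta>}" "v \<in> {\<alpha>..\<beta>}" "\<kappa> \<le> \<bar>u - v\<bar>" for u v
  proof -
    have *: "good u v" if "u \<in> {\<alpha>..\<beta>}" "v \<in> {\<alpha>..\<beta>}" "\<kappa> \<le> v - u" for u v
    proof -
      have "(u, v) \<in> R" using that by (auto simp: R_def)
      from pmax[OF this] show ?thesis
        using that \<open>0 < \<kappa>\<close> by (simp add: good_def L_def[symmetric] pos_divide_le_eq)
    qed
    show ?thesis
      using *[of u v] *[of v u] good_sym[of v u] uv by (cases "u \<le> v") auto
  qed
  have rescale: "\<exists>u' v'. u' \<in> {\<alpha>..\<beta>} \<and> v' \<in> {\<alpha>..\<beta>} \<and> \<bar>u - v\<bar> \<le> \<rho> * \<bar>u' - v'\<bar> \<and>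
      (good u' v' \<longrightarrow> good u v) \<and> (u \<in> {lo i, hi i} \<longrightarrow> u' \<in> {\<alpha>, \<beta>})"
    if i: "i \<in> I" and uvJ: "u \<in> {lo i..hi i}" "v \<in> {lo i..hi i}" for i u v
  proof -
    obtain u' v' where u': "u' \<in> {\<alpha>..\<beta>}" "u = m i * u' + c i" and v': "v' \<in> {\<alpha>..\<beta>}" "v = m i * v' + c i"
      using uvJ unfolding J[OF i, symmetric] by blast
    have uv: "\<bar>u - v\<bar> = \<bar>m i\<bar> * \<bar>u' - v'\<bar>"
      by (simp add: u' v' flip: abs_mult right_diff_distrib)
    have "good u v" if "good u' v'"
      using similar[OF i u'(1) v'(1)] that mult_left_mono[of "dist (G u') (G v')" "L * \<bar>u' - v'\<bar>" "\<bar>m i\<bar>"]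
      unfolding good_def uv u'(2)[symmetric] v'(2)[symmetric] by (simp add: mult.left_commute)
    moreover have "u' \<in> {\<alpha>, \<beta>}" if "u \<in> {lo i, hi i}"
      using that m[OF i] by (auto simp: lo_def hi_def u' min_def max_def split: if_splits)
    moreover have "\<bar>u - v\<bar> \<le> \<rho> * \<bar>u' - v'\<bar>"
      unfolding uv using \<rho>[OF i] by (simp add: mult_right_mono)
    ultimately show ?thesis using u' v' by blast
  qed
  have expand: "\<kappa> * \<rho> ^ n \<le> d'" if "\<kappa> * \<rho> ^ Suc n \<le> d" "d \<le> \<rho> * d'" for d d' :: real and n
  proof -
    have "\<rho> * (\<kappa> * \<rho> ^ n) \<le> \<rho> * d'" using that by (simp add: mult.left_commute)
    then show ?thesis using \<open>0 < \<rho>\<close> by simp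
  qed

  \<comment> \<open>Pairs containing an end of the interval; \<open>n\<close> bounds the number of magnifications.\<close>
  have end_aux: "good e v" if "e \<in> {\<alpha>, \<beta>}" "v \<in> {\<alpha>..\<beta>}" "e \<noteq> v" "\<kappa> * \<rho> ^ n \<le> \<bar>e - v\<bar>" for e v n
    using that
  proof (induction n arbitrary: e v)
    case 0
    then show ?case using far[of e v] \<open>\<alpha> < \<beta>\<close> by auto
  next
    case (Suc n)
    show ?case
    proof (cases "\<kappa> \<le> \<bar>e - v\<bar>")
      case True
      then show ?thesis using far[of e v] Suc.prems \<open>\<alpha> < \<beta>\<close> by auto
    next
      case False
      \<comment> \<open>A piece over the midpoint has no end strictly between \<open>e\<close> and \<open>v\<close>, as this would be
        closer than \<open>\<kappa>\<close> to the end \<open>e\<close>.\<close>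
      have "(e + v) / 2 \<in> {\<alpha>..\<beta>}" using Suc.prems \<open>\<alpha> < \<beta>\<close> by auto
      then obtain i where i: "i \<in> I" "lo i \<le> (e + v) / 2" "(e + v) / 2 \<le> hi i" using piece by blast
      have "e \<in> {lo i, hi i} \<and> e \<in> {lo i..hi i} \<and> v \<in> {lo i..hi i}"
        using Suc.prems False i range[OF i(1)] gap[of \<alpha> "lo i"] gap[of \<alpha> "hi i"] gap[of \<beta> "lo i"] gap[of \<beta> "hi i"]
          E i(1) by (auto simp: abs_if field_simps split: if_splits)
      then obtain u' v' where "u' \<in> {\<alpha>, \<beta>}" "v' \<in> {\<alpha>..\<beta>}" "\<bar>e - v\<bar> \<le> \<rho> * \<bar>u' - v'\<bar>"
          "good u' v' \<longrightarrow> good e v"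
        using rescale[OF i(1), of e v] by blast
      moreover from this have "u' \<noteq> v'" using Suc.prems by auto
      ultimately show ?thesis using Suc.IH expand Suc.prems by blast
    qed
  qed
  have scale_ex: "\<exists>n. \<kappa> * \<rho> ^ n \<le> d" if "0 < d" for d
  proof -
    obtain n where "\<rho> ^ n < d / \<kappa>"
      using real_arch_pow_inv[of "d / \<kappa>" \<rho>] \<open>\<rho> < 1\<close> \<open>0 < \<kappa>\<close> \<open>0 < d\<close> by auto
    then show ?thesis using \<open>0 < \<kappa>\<close> by (intro exI[of _ n]) (simp add: field_simps)
  qed
  have good_end: "good e v" if "e \<in> {\<alpha>, \<beta>}" "v \<in> {\<alpha>..\<beta>}" for e v
    using end_aux[OF that] scale_ex[of "\<bar>e - v\<bar>"] by (cases "e = v") (auto simp: good_def)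
  have good_piece_end: "good u v"
    if "i \<in> I" "u \<in> {lo i, hi i}" "v \<in> {lo i..hi i}" for i u v
  proof -
    have "u \<in> {lo i..hi i}" using that(2) range(3)[OF that(1)] by auto
    then show ?thesis using rescale[OF that(1) _ that(3), of u] that(2) good_end by blast
  qed

  \<comment> \<open>Arbitrary pairs, again by the number of magnifications.\<close>
  have aux: "good u v" if "\<alpha> \<le> u" "u < v" "v \<le> \<beta>" "\<kappa> * \<rho> ^ n \<le> v - u" for u v n
    using that
  proof (induction n arbitrary: u v)
    case 0
    then show ?case using far[of u v] by auto
  next
    case (Suc n)
    have one: "good u v" if i: "i \<in> I" "lo i \<le> u" "v \<le> hi i" for i
    proof -
      obtain u' v' where uv': "u' \<in> {\<alpha>..\<beta>}" "v' \<in> {\<alpha>..\<beta>}" "\<bar>u - v\<bar> \<le> \<rho> * \<bar>u' - v'\<bar>"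
          "good u' v' \<longrightarrow> good u v"
        using rescale[OF i(1), of u v] i Suc.prems by auto
      then have "u' \<noteq> v'" using Suc.prems by auto
      moreover have "\<kappa> * \<rho> ^ n \<le> \<bar>u' - v'\<bar>" using expand[OF _ uv'(3)] Suc.prems by auto
      ultimately have "good u' v' \<or> good v' u'"
        using Suc.IH[of u' v'] Suc.IH[of v' u'] uv' by (cases u' v' rule: linorder_cases) auto
      then show ?thesis using uv' good_sym by blast
    qed
    show ?case
    proof (cases "\<kappa> \<le> v - u")
      case True
      then show ?thesis using far[of u v] Suc.prems by auto
    next
      case False
      \<comment> \<open>A piece over a point between two neighbouring ends of pieces covers everything between
        these ends, which is why the pieces below are chosen over midpoints.\<close>
      have cut_unique: "x = y" if "x \<in> E" "y \<in> E" "u < x" "x < v" "u < y" "y < v" for x y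
        using gap[OF that(1,2)] that False by linarith
      show ?thesis
      proof (cases "\<exists>e\<in>E. u < e \<and> e < v")
        case False
        have "(u + v) / 2 \<in> {\<alpha>..\<beta>}" using Suc.prems by auto
        then obtain i where i: "i \<in> I" "lo i \<le> (u + v) / 2" "(u + v) / 2 \<le> hi i" using piece by blast
        have "lo i \<le> u" "v \<le> hi i" using False E(3,4)[OF i(1)] i Suc.prems by force+
        then show ?thesis using one i by blast
      next
        case True
        then obtain e where e: "e \<in> E" "u < e" "e < v" by blast
        have "(u + e) / 2 \<in> {\<alpha>..\<beta>}" using Suc.prems e by auto
        then obtain i where i: "i \<in> I" "lo i \<le> (u + e) / 2" "(u + e) / 2 \<le> hi i" using piece by blast
        have "lo i \<le> u" using cut_unique[OF E(3)[OF i(1)] e(1)] i e by force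
        have "hi i = e \<or> v \<le> hi i" using cut_unique[OF E(4)[OF i(1)] e(1)] i e by force
        have "(e + v) / 2 \<in> {\<alpha>..\<beta>}" using Suc.prems e by auto
        then obtain j where j: "j \<in> I" "lo j \<le> (e + v) / 2" "(e + v) / 2 \<le> hi j" using piece by blast
        have "v \<le> hi j" using cut_unique[OF E(4)[OF j(1)] e(1)] j e by force
        have "lo j = e \<or> lo j \<le> u" using cut_unique[OF E(3)[OF j(1)] e(1)] j e by force
        show ?thesis
        proof (cases "v \<le> hi i \<or> lo j \<le> u")
          case True
          then show ?thesis using one i j \<open>lo i \<le> u\<close> \<open>v \<le> hi j\<close> by blast
        next
          case False
          then have "hi i = e" "lo j = e"
            using \<open>hi i = e \<or> v \<le> hi i\<close> \<open>lo j = e \<or> lo j \<le> u\<close> by auto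
          then have "good e u" "good e v"
            using good_piece_end[of i e u] good_piece_end[of j e v] i j e \<open>lo i \<le> u\<close> \<open>v \<le> hi j\<close> by auto
          then show ?thesis using good_trans[of u e v] good_sym e by auto
        qed
      qed
    qed
  qed
  have good_less: "good u v" if "\<alpha> \<le> u" "u < v" "v \<le> \<beta>" for u v
    using aux[OF that] scale_ex[of "v - u"] that by auto
  have "good u v" if "u \<in> {\<alpha>..\<beta>}" "v \<in> {\<alpha>..\<beta>}" for u v
    using good_less[of u v] good_less[of v u] good_sym[of v u] that
    by (cases u v rule: linorder_cases) (auto simp: good_def)
  moreover have "\<alpha> \<le> fst p" "fst p < snd p" "snd p \<le> \<beta>"
    using p \<open>0 < \<kappa>\<close> by (auto simp: R_def)
  moreover from this have "dist (G (fst p)) (G (snd p)) = L * (snd p - fst p)"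
    by (simp add: L_def)
  ultimately show ?thesis using that unfolding good_def by blast
qed

section \<open>Self-similar arcs with a scaled functional are straight\<close>

text \<open>
  The hypothesis turns additivity of lengths of intervals into equality in the triangle
  inequality, so \<open>\<gamma>\<close> lies in the segment.  It fills the segment because \<open>b\<close> is injective on the
  segment and takes all intermediate values on \<open>\<gamma>\<close>.
\<close>
lemma dist_proportional_to_functional_imp_segment:
  fixes \<gamma> :: "'a::euclidean_space set"
  assumes dist: "\<And>x y. x \<in> \<gamma> \<Longrightarrow> y \<in> \<gamma> \<Longrightarrow> dist x y = L * \<bar>b \<bullet> x - b \<bullet> y\<bar>"
    and img: "(\<bullet>) b ` \<gamma> = {b \<bullet> p..b \<bullet> q}" and pq: "p \<in> \<gamma>" "q \<in> \<gamma>" "b \<bullet> p < b \<bullet> q"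
  shows "\<gamma> = closed_segment p q"
proof
  show sub: "\<gamma> \<subseteq> closed_segment p q"
  proof
    fix x assume x: "x \<in> \<gamma>"
    then have "b \<bullet> x \<in> {b \<bullet> p..b \<bullet> q}" using img by blast
    then have "dist p q = dist p x + dist x q"
      using pq by (simp add: dist x algebra_simps)
    then show "x \<in> closed_segment p q" by (simp add: between flip: between_mem_segment)
  qed
  show "closed_segment p q \<subseteq> \<gamma>"
  proof
    fix w assume w: "w \<in> closed_segment p q"
    then obtain u where u: "0 \<le> u" "u \<le> 1" "w = (1 - u) *\<^sub>R p + u *\<^sub>R q"
      by (auto simp: in_segment)
    have bu: "b \<bullet> ((1 - v) *\<^sub>R p + v *\<^sub>R q) = b \<bullet> p + v * (b \<bullet> q - b \<bullet> p)" for v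
      by (simp add: inner_add_right algebra_simps)
    have "0 \<le> u * (b \<bullet> q - b \<bullet> p)" "u * (b \<bullet> q - b \<bullet> p) \<le> b \<bullet> q - b \<bullet> p"
      using u pq(3) by (simp_all add: mult_left_le_one_le)
    then have "b \<bullet> w \<in> (\<bullet>) b ` \<gamma>" unfolding img u(3) bu by simp
    then obtain x where x: "x \<in> \<gamma>" "b \<bullet> x = b \<bullet> w" by auto
    then have "x \<in> closed_segment p q" using sub by blast
    then obtain v where v: "x = (1 - v) *\<^sub>R p + v *\<^sub>R q" by (auto simp: in_segment)
    then have "u = v" using x(2) pq(3) unfolding u(3) by (simp add: bu)
    then show "w \<in> \<gamma>" using x u v by simp
  qed
qed

text \<open>
  The arc is reparametrised by the value of \<open>b\<close> to make it the graph of \<open>G\<close>, on which each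
  similarity acts by an affine map of the parameter; the previous section then provides a
  steepest chord, from \<open>G s\<close> to \<open>G t\<close>.
\<close>
lemma self_similar_arc_is_segment:
  fixes g :: "real \<Rightarrow> 'a::euclidean_space"
  assumes "arc g" and b: "strict_mono_on {0..1} (\<lambda>t. b \<bullet> g t)"
    and "finite F" and \<gamma>: "path_image g = (\<Union>S\<in>F. S ` path_image g)"
    and scale: "\<And>S. S \<in> F \<Longrightarrow> \<exists>m. 0 < \<bar>m\<bar> \<and> \<bar>m\<bar> < 1 \<and> scales_by b m S"
  shows "path_image g = closed_segment (g 0) (g 1)"
proof -
  define \<Gamma> where "\<Gamma> = path_image g"
  define \<alpha> \<beta> where "\<alpha> = b \<bullet> g 0" and "\<beta> = b \<bullet> g 1"
  obtain m where m: "\<And>S. S \<in> F \<Longrightarrow> 0 < \<bar>m S\<bar> \<and> \<bar>m S\<bar> < 1 \<and> scales_by b (m S) S"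
    using scale by metis
  have \<Gamma>: "\<Gamma> = (\<Union>S\<in>F. S ` \<Gamma>)" using \<gamma> by (simp only: \<Gamma>_def)
  have "compact \<Gamma>" "connected \<Gamma>"
    using \<open>arc g\<close> by (simp_all add: \<Gamma>_def arc_imp_path compact_path_image connected_path_image)
  have ends: "g 0 \<in> \<Gamma>" "g 1 \<in> \<Gamma>" by (simp_all add: \<Gamma>_def path_image_def)
  have "\<alpha> < \<beta>" using strict_mono_onD[OF b, of 0 1] by (simp add: \<alpha>_def \<beta>_def)
  have bcont: "continuous_on \<Gamma> ((\<bullet>) b)" by (intro continuous_intros)
  have img: "(\<bullet>) b ` \<Gamma> = {\<alpha>..\<beta>}"
  proof
    show "(\<bullet>) b ` \<Gamma> \<subseteq> {\<alpha>..\<beta>}"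
      using strict_mono_on_leD[OF b, of 0] strict_mono_on_leD[OF b, of _ 1]
      by (auto simp: \<Gamma>_def \<alpha>_def \<beta>_def path_image_def)
    have "connected ((\<bullet>) b ` \<Gamma>)" using connected_continuous_image[OF bcont \<open>connected \<Gamma>\<close>] .
    then show "{\<alpha>..\<beta>} \<subseteq> (\<bullet>) b ` \<Gamma>"
      using ends by (intro connected_contains_Icc) (auto simp: \<alpha>_def \<beta>_def)
  qed
  have "inj_on ((\<bullet>) b) \<Gamma>"
    using strict_mono_on_imp_inj_on[OF b] by (auto simp: \<Gamma>_def inj_on_def path_image_def)
  define G where "G = the_inv_into \<Gamma> ((\<bullet>) b)"
  have Gb: "G (b \<bullet> x) = x" if "x \<in> \<Gamma>" for x
    unfolding G_def using the_inv_into_f_f[OF \<open>inj_on ((\<bullet>) b) \<Gamma>\<close> that] .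
  have GI: "G t \<in> \<Gamma> \<and> b \<bullet> G t = t" if "t \<in> {\<alpha>..\<beta>}" for t
    using that Gb unfolding img[symmetric] by auto
  have "continuous_on {\<alpha>..\<beta>} G"
    using continuous_on_inv[OF bcont \<open>compact \<Gamma>\<close>, of G] Gb by (simp add: img)
  have sG: "m S * t + b \<bullet> S 0 = b \<bullet> S (G t)" if "S \<in> F" "t \<in> {\<alpha>..\<beta>}" for S t
  proof -
    have "b \<bullet> S (G t) - b \<bullet> S 0 = m S * (b \<bullet> G t - b \<bullet> 0)"
      using m[OF that(1)] unfolding scales_by_def by blast
    then show ?thesis using GI[OF that(2)] by simp
  qed
  have Gs: "G (m S * t + b \<bullet> S 0) = S (G t)" if "S \<in> F" "t \<in> {\<alpha>..\<beta>}" for S t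
  proof -
    have "S (G t) \<in> \<Gamma>" using \<Gamma> GI[OF that(2)] that(1) by blast
    then show ?thesis using Gb sG[OF that] by simp
  qed
  have cover: "{\<alpha>..\<beta>} = (\<Union>S\<in>F. (\<lambda>t. m S * t + b \<bullet> S 0) ` {\<alpha>..\<beta>})"
  proof -
    have "G ` {\<alpha>..\<beta>} = \<Gamma>" unfolding img[symmetric] image_image using Gb by simp
    have "{\<alpha>..\<beta>} = (\<bullet>) b ` (\<Union>S\<in>F. S ` \<Gamma>)" using img \<Gamma> by simp
    also have "\<dots> = (\<Union>S\<in>F. (\<lambda>t. b \<bullet> S (G t)) ` {\<alpha>..\<beta>})"
      by (simp add: image_UN image_image flip: \<open>G ` {\<alpha>..\<beta>} = \<Gamma>\<close>)
    also have "\<dots> = (\<Union>S\<in>F. (\<lambda>t. m S * t + b \<bullet> S 0) ` {\<alpha>..\<beta>})"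
      by (intro SUP_cong image_cong) (auto simp: sG)
    finally show ?thesis .
  qed
  obtain L s t where st: "\<alpha> \<le> s" "s < t" "t \<le> \<beta>" and L: "dist (G s) (G t) = L * (t - s)"
    and slope: "\<And>u v. u \<in> {\<alpha>..\<beta>} \<Longrightarrow> v \<in> {\<alpha>..\<beta>} \<Longrightarrow> dist (G u) (G v) \<le> L * \<bar>u - v\<bar>"
  proof (rule self_affine_graph_attains_max_slope[OF \<open>\<alpha> < \<beta>\<close> \<open>finite F\<close> \<open>continuous_on {\<alpha>..\<beta>} G\<close> _ cover])
    show "dist (G (m S * u + b \<bullet> S 0)) (G (m S * v + b \<bullet> S 0)) = \<bar>m S\<bar> * dist (G u) (G v)"
      if "S \<in> F" "u \<in> {\<alpha>..\<beta>}" "v \<in> {\<alpha>..\<beta>}" for S u v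
      using m[OF that(1)] that by (simp add: Gs scales_by_def)
  qed (use m in auto)
  \<comment> \<open>The slopes of the three consecutive chords from \<open>s\<close> to \<open>t\<close> are at most \<open>L\<close>, and together
    they have to reach slope \<open>L\<close>.\<close>
  have tight_less: "dist (G u) (G v) = L * (v - u)" if "s \<le> u" "u \<le> v" "v \<le> t" for u v
  proof -
    have "L * (t - s) \<le> dist (G s) (G u) + dist (G u) (G v) + dist (G v) (G t)"
      unfolding L[symmetric]
      using dist_triangle[of "G s" "G t" "G u"] dist_triangle[of "G u" "G t" "G v"] by linarith
    moreover have "L * (t - s) = L * (u - s) + L * (v - u) + L * (t - v)"
      by (simp add: algebra_simps)
    ultimately show ?thesis
      using slope[of s u] slope[of u v] slope[of v t] st that by simp
  qed
  have tight: "dist x y = L * \<bar>b \<bullet> x - b \<bullet> y\<bar>"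
    if "x \<in> \<Gamma>" "y \<in> \<Gamma>" "b \<bullet> x \<in> {s..t}" "b \<bullet> y \<in> {s..t}" for x y
    using tight_less[of "b \<bullet> x" "b \<bullet> y"] tight_less[of "b \<bullet> y" "b \<bullet> x"] that
    by (cases "b \<bullet> x \<le> b \<bullet> y") (auto simp: Gb dist_commute)
  \<comment> \<open>A whole copy of the arc lies over the interval from \<open>s\<close> to \<open>t\<close>.\<close>
  define z where "z = G ((s + t) / 2)"
  have z: "z \<in> \<Gamma>" "b \<bullet> z = (s + t) / 2" using GI[of "(s + t) / 2"] st by (auto simp: z_def)
  define N where "N = {w. s < b \<bullet> w} \<inter> {w. b \<bullet> w < t}"
  have "open N" unfolding N_def by (intro open_Int open_Collect_less continuous_intros)
  moreover have "z \<in> N" using z st by (simp add: N_def)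
  ultimately obtain \<delta> where \<delta>: "0 < \<delta>" "ball z \<delta> \<subseteq> N" using open_contains_ball by blast
  obtain W k where W: "k \<noteq> 0" "scales_by b k W" "W ` \<Gamma> \<subseteq> \<Gamma>" "W ` \<Gamma> \<subseteq> ball z \<delta>"
    by (rule arbitrarily_small_copy[OF \<open>finite F\<close> \<Gamma> compact_imp_bounded[OF \<open>compact \<Gamma>\<close>] z(1) scale \<delta>(1)])
  have "dist x y = L * \<bar>b \<bullet> x - b \<bullet> y\<bar>" if xy: "x \<in> \<Gamma>" "y \<in> \<Gamma>" for x y
  proof -
    have "W x \<in> N" "W y \<in> N" using W(4) \<delta>(2) xy by blast+
    then have "dist (W x) (W y) = L * \<bar>b \<bullet> W x - b \<bullet> W y\<bar>"
      using W(3) xy by (intro tight) (auto simp: N_def)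
    moreover have "dist (W x) (W y) = \<bar>k\<bar> * dist x y" "b \<bullet> W x - b \<bullet> W y = k * (b \<bullet> x - b \<bullet> y)"
      using W(2) by (simp_all add: scales_by_def)
    ultimately show ?thesis using W(1) by (simp add: abs_mult)
  qed
  then have "\<Gamma> = closed_segment (g 0) (g 1)"
    using img ends \<open>\<alpha> < \<beta>\<close> unfolding \<alpha>_def \<beta>_def
    by (intro dist_proportional_to_functional_imp_segment[where b = b and L = L]) auto
  then show ?thesis by (simp add: \<Gamma>_def)
qed

section \<open>Arcs met once by parallel hyperplanes\<close>

lemma affine_parallel_hyperplanes:
  fixes a :: "'a::real_inner"
  assumes "a \<noteq> 0"
  shows "affine_parallel {x. a \<bullet> x = c} {x. a \<bullet> x = d}"
proof -
  define v where "v = ((d - c) / (a \<bullet> a)) *\<^sub>R a"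
  have v: "a \<bullet> v = d - c" using assms by (simp add: v_def)
  have "x \<in> (+) v ` {x. a \<bullet> x = c}" if "a \<bullet> x = d" for x
    using that v by (intro image_eqI[of _ _ "x - v"]) (auto simp: inner_diff_right)
  then have "{x. a \<bullet> x = d} = (+) v ` {x. a \<bullet> x = c}"
    using v by (auto simp: inner_add_right)
  then show ?thesis unfolding affine_parallel_def by blast
qed

theorem theorem1:
  fixes \<gamma> \<sigma> :: "(real ^ 'd) set"
  assumes "self_similar_jordan_arc \<gamma>"
    and "is_hyperplane \<sigma>"
    and "\<And>x \<tau>. x \<in> \<gamma> \<Longrightarrow> is_hyperplane \<tau> \<Longrightarrow> affine_parallel \<sigma> \<tau> \<Longrightarrow> x \<in> \<tau> \<Longrightarrow> \<tau> \<inter> \<gamma> = {x}"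
  shows "\<exists>a b. a \<noteq> b \<and> \<gamma> = closed_segment a b"
proof -
  obtain g F where "arc g" and g: "path_image g = \<gamma>" and "finite F"
    and F: "\<And>S. S \<in> F \<Longrightarrow> contraction_similarity S" and \<gamma>: "\<gamma> = (\<Union>S\<in>F. S ` \<gamma>)"
    using assms(1) unfolding self_similar_jordan_arc_def jordan_arc_def by blast
  obtain n c where "n \<noteq> 0" and \<sigma>: "\<sigma> = {x. n \<bullet> x = c}"
    using assms(2) unfolding is_hyperplane_def by blast
  have "inj_on ((\<bullet>) n) \<gamma>"
  proof (rule inj_onI)
    fix x y assume xy: "x \<in> \<gamma>" "y \<in> \<gamma>" "n \<bullet> x = n \<bullet> y"
    have "is_hyperplane {w. n \<bullet> w = n \<bullet> x}"
      using \<open>n \<noteq> 0\<close> unfolding is_hyperplane_def by blast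
    moreover have "affine_parallel \<sigma> {w. n \<bullet> w = n \<bullet> x}"
      using affine_parallel_hyperplanes[OF \<open>n \<noteq> 0\<close>] \<sigma> by blast
    ultimately have "{w. n \<bullet> w = n \<bullet> x} \<inter> \<gamma> = {x}"
      using assms(3)[OF xy(1)] by blast
    then show "x = y" using xy by auto
  qed
  then obtain a where a: "strict_mono_on {0..1} (\<lambda>t. a \<bullet> g t)"
    using strictly_monotone_along_arc[OF \<open>arc g\<close>] g by blast
  have \<gamma>': "path_image g = (\<Union>S\<in>F. S ` path_image g)" using \<gamma> by (simp only: g)
  obtain b where b: "mono_on {0..1} (\<lambda>t. b \<bullet> g t)" "b \<bullet> g 0 < b \<bullet> g 1"
    and scale: "\<And>S. S \<in> F \<Longrightarrow> \<exists>m. 0 < \<bar>m\<bar> \<and> \<bar>m\<bar> < 1 \<and> scales_by b m S"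
    using common_scaled_functional[OF \<open>arc g\<close> a F] \<gamma>' by blast
  have "strict_mono_on {0..1} (\<lambda>t. b \<bullet> g t)"
    using scaled_functional_strictly_monotone[OF \<open>arc g\<close> a \<open>finite F\<close> \<gamma>' b scale] by blast
  then have "path_image g = closed_segment (g 0) (g 1)"
    using self_similar_arc_is_segment[OF \<open>arc g\<close> _ \<open>finite F\<close> \<gamma>' scale] by blast
  then show ?thesis using g b(2) by (intro exI[of _ "g 0"] exI[of _ "g 1"]) auto
qed

end
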